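(* Let $D=(V,A)$ be a digraph (of arbitrary cardinality, multiple edges and loops allowed), let $k\in\mathbb{N}$, and let $\mathcal{B}_i=(V_i,A_i)$ $(i<k)$ be pairwise edge-disjoint branchings in $D$. Let $D\setminus\!\setminus\mathcal{B}=(V,A\setminus\bigcup_{i<k}A_i)$, and suppose that $D\setminus\!\setminus\mathcal{B}$ contains no forward-infinite path. Then the following are equivalent: (i) there are pairwise edge-disjoint spanning branchings $\mathcal{B}_i'$ $(i<k)$ of $D$ such that each $\mathcal{B}_i'$ contains $\mathcal{B}_i$ as a subgraph and has the same root set as $\mathcal{B}_i$; (ii) for every nonempty $X\subseteq V$, $$\varrho_{D\setminus\!\setminus\mathcal{B}}(X)\ \geq\ \left|\{i<k: V_i\cap X=\varnothing\}\right|.$$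
   Context: An arborescence with root $r$ is a digraph that is a directed tree in which every vertex is reachable from $r$ by a (finite) directed path. A branching is a digraph whose weakly connected components are arborescences; its root set is the set of roots of these arborescences. A branching in $D$ is a subgraph of $D$ that is a branching; it is spanning if its vertex set is $V$. For $X\subseteq V$ and a digraph $H$ on $V$, $\varrho_H(X)$ denotes the (possibly infinite) cardinality of the set of edges of $H$ whose tail is outside $X$ and whose head is in $X$. A forward-infinite path is a directed path $x_0x_1x_2\dots$ with infinitely many distinct vertices and a first vertex. Here $V_i$ denotes the vertex set of $\mathcal{B}_i$ and $A_i$ its edge set. *)

theory Defs
  imports Main "HOL-Library.Extended_Nat"
begin

text \<open>A digraph is given by a vertex set V, an edge set A (of an arbitrary edge type,
so multiple edges and loops are allowed) and tail/head maps. A subgraph is a pair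
(W, F) of a vertex set and an edge set, with the same tail/head maps.\<close>

definition arc_rel :: "('e \<Rightarrow> 'v) \<Rightarrow> ('e \<Rightarrow> 'v) \<Rightarrow> 'e set \<Rightarrow> ('v \<times> 'v) set" where
  "arc_rel tail head F = {(tail e, head e) | e. e \<in> F}"

definition und_rel :: "('e \<Rightarrow> 'v) \<Rightarrow> ('e \<Rightarrow> 'v) \<Rightarrow> 'e set \<Rightarrow> ('v \<times> 'v) set" where
  "und_rel tail head F = arc_rel tail head F \<union> (arc_rel tail head F)\<inverse>"

text \<open>A cycle of the underlying undirected multigraph (loops are cycles of length 1,
two parallel edges form a cycle of length 2).\<close>
definition und_cycle :: "('e \<Rightarrow> 'v) \<Rightarrow> ('e \<Rightarrow> 'v) \<Rightarrow> 'e set \<Rightarrow> bool" where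
  "und_cycle tail head F \<longleftrightarrow>
     (\<exists>es vs. length es \<ge> 1 \<and> length vs = Suc (length es) \<and> distinct es \<and> set es \<subseteq> F \<and>
        vs ! (length es) = vs ! 0 \<and> distinct (butlast vs) \<and>
        (\<forall>i < length es. (tail (es ! i) = vs ! i \<and> head (es ! i) = vs ! Suc i) \<or>
                          (head (es ! i) = vs ! i \<and> tail (es ! i) = vs ! Suc i)))"

definition is_digraph :: "('e \<Rightarrow> 'v) \<Rightarrow> ('e \<Rightarrow> 'v) \<Rightarrow> 'v set \<Rightarrow> 'e set \<Rightarrow> bool" where
  "is_digraph tail head W F \<longleftrightarrow> (\<forall>e\<in>F. tail e \<in> W \<and> head e \<in> W)"

text \<open>Arborescence with root r: a directed tree (underlying multigraph connected and
acyclic) in which every vertex is reachable from r by a finite directed path.\<close>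
definition is_arborescence :: "('e \<Rightarrow> 'v) \<Rightarrow> ('e \<Rightarrow> 'v) \<Rightarrow> 'v set \<Rightarrow> 'e set \<Rightarrow> 'v \<Rightarrow> bool" where
  "is_arborescence tail head W F r \<longleftrightarrow>
     is_digraph tail head W F \<and> r \<in> W \<and>
     (\<forall>u\<in>W. \<forall>v\<in>W. (u, v) \<in> (und_rel tail head F)\<^sup>*) \<and>
     \<not> und_cycle tail head F \<and>
     (\<forall>v\<in>W. (r, v) \<in> (arc_rel tail head F)\<^sup>*)"

text \<open>Weakly connected component of u in (W, F), and its edge set.\<close>
definition wcomp :: "('e \<Rightarrow> 'v) \<Rightarrow> ('e \<Rightarrow> 'v) \<Rightarrow> 'v set \<Rightarrow> 'e set \<Rightarrow> 'v \<Rightarrow> 'v set" where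
  "wcomp tail head W F u = {w \<in> W. (u, w) \<in> (und_rel tail head F)\<^sup>*}"

definition wcomp_arcs :: "('e \<Rightarrow> 'v) \<Rightarrow> ('e \<Rightarrow> 'v) \<Rightarrow> 'e set \<Rightarrow> 'v set \<Rightarrow> 'e set" where
  "wcomp_arcs tail head F C = {e \<in> F. tail e \<in> C \<and> head e \<in> C}"

text \<open>Branching: every weakly connected component is an arborescence.\<close>
definition is_branching :: "('e \<Rightarrow> 'v) \<Rightarrow> ('e \<Rightarrow> 'v) \<Rightarrow> 'v set \<Rightarrow> 'e set \<Rightarrow> bool" where
  "is_branching tail head W F \<longleftrightarrow>
     is_digraph tail head W F \<and>
     (\<forall>u\<in>W. \<exists>r. is_arborescence tail head (wcomp tail head W F u)
                   (wcomp_arcs tail head F (wcomp tail head W F u)) r)"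

text \<open>Root set: the roots of the arborescences (components).\<close>
definition root_set :: "('e \<Rightarrow> 'v) \<Rightarrow> ('e \<Rightarrow> 'v) \<Rightarrow> 'v set \<Rightarrow> 'e set \<Rightarrow> 'v set" where
  "root_set tail head W F =
     {r \<in> W. is_arborescence tail head (wcomp tail head W F r)
               (wcomp_arcs tail head F (wcomp tail head W F r)) r}"

text \<open>(W, F) is a branching in the digraph (V, A).\<close>
definition branching_in :: "('e \<Rightarrow> 'v) \<Rightarrow> ('e \<Rightarrow> 'v) \<Rightarrow> 'v set \<Rightarrow> 'e set \<Rightarrow> 'v set \<Rightarrow> 'e set \<Rightarrow> bool" where
  "branching_in tail head V A W F \<longleftrightarrow> W \<subseteq> V \<and> F \<subseteq> A \<and> is_branching tail head W F"

text \<open>In-degree of X in the digraph with edge set F (possibly infinite).\<close>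
definition rho :: "('e \<Rightarrow> 'v) \<Rightarrow> ('e \<Rightarrow> 'v) \<Rightarrow> 'e set \<Rightarrow> 'v set \<Rightarrow> enat" where
  "rho tail head F X =
     (let E = {e \<in> F. tail e \<notin> X \<and> head e \<in> X} in if finite E then enat (card E) else \<infinity>)"

text \<open>Forward-infinite path: an injective sequence of vertices joined by consecutive edges.\<close>
definition has_forward_infinite_path :: "('e \<Rightarrow> 'v) \<Rightarrow> ('e \<Rightarrow> 'v) \<Rightarrow> 'e set \<Rightarrow> bool" where
  "has_forward_infinite_path tail head F \<longleftrightarrow>
     (\<exists>x :: nat \<Rightarrow> 'v. inj x \<and> (\<forall>n. \<exists>e\<in>F. tail e = x n \<and> head e = x (Suc n)))"

end

theory Submission
  imports Defs
begin

text \<open>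
  Enlarge the branchings arc by arc while keeping condition (ii) valid for the vertex sets reached so
  far. Two ideas make this work in infinite digraphs.

  (1) A fixed vertex can be added to a fixed branching by finitely many such steps. If not, look at
  tight sets (with equality in the cut condition for the other indices) containing a vertex that can
  never be added. Inside every such set, after finitely many steps, there is a smaller one entered by
  an arc from the larger one. All vertices of a tight set are reachable inside it from the head of any
  entering arc. Only boundedly many entering arcs can have a head lying in all later tight
  sets, so beyond some point every new entering arc has a head that can be left behind again; walking
  from such heads into ever smaller tight sets yields a forward-infinite path.

  (2) Call a state full if the head of each added arc lies in all the branchings. If some branching
  misses \<open>X\<close>, then in a full state no added arc enters \<open>X\<close>, so full states inherit condition (ii) from
  the beginning and limits cause no trouble. By (1), applied infinitely often, every non-spanning full
  state has a proper full extension, and Zorn's lemma finishes the proof.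
\<close>

section \<open>Paths\<close>

lemma rtrancl_distinct_path:
  assumes "(x, y) \<in> r\<^sup>*"
  shows "\<exists>p. p \<noteq> [] \<and> hd p = x \<and> last p = y \<and> distinct p \<and> successively (\<lambda>a b. (a, b) \<in> r) p"
  using assms
proof (induction rule: converse_rtrancl_induct)
  case base
  show ?case by (rule exI[of _ "[y]"]) simp
next
  case (step x z)
  then obtain p where p: "p \<noteq> []" "hd p = z" "last p = y" "distinct p"
    "successively (\<lambda>a b. (a, b) \<in> r) p" by blast
  show ?case
  proof (cases "x \<in> set p")
    case True
    then obtain as bs where "p = as @ x # bs" by (auto dest: split_list)
    with p show ?thesis
      by (intro exI[of _ "x # bs"]) (auto simp: successively_append_iff)
  next
    case False
    with p step(1) show ?thesis
      by (intro exI[of _ "x # p"]) (cases p, auto)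
  qed
qed

lemma successively_nthD:
  "successively P xs \<Longrightarrow> Suc i < length xs \<Longrightarrow> P (xs ! i) (xs ! Suc i)"
proof (induction xs arbitrary: i rule: induct_list012)
  case (3 x y zs)
  then show ?case by (cases i) auto
qed auto

text \<open>A repetition-free path is cut at its first visit to \<open>B\<close>. The end
  \<open>z\<close> is kept apart from \<open>q\<close> so that everything before it avoids
  \<open>B\<close>.\<close>

lemma rtrancl_path_to_set:
  assumes "(x, y) \<in> r\<^sup>*" "x \<notin> B" "y \<in> B"
  shows "\<exists>q z. distinct (x # q) \<and> set (x # q) \<inter> B = {} \<and> z \<in> B \<and>
    successively (\<lambda>a b. (a, b) \<in> r) (x # q @ [z])"
proof -
  obtain p where p: "p \<noteq> []" "hd p = x" "last p = y" "distinct p"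
    "successively (\<lambda>a b. (a, b) \<in> r) p"
    using rtrancl_distinct_path[OF assms(1)] by blast
  from p assms have "\<exists>z\<in>set p. z \<in> B" by (metis last_in_set)
  then obtain as z bs where sp: "p = as @ z # bs" "z \<in> B" "\<forall>w\<in>set as. w \<notin> B"
    using split_list_first_prop[of p "\<lambda>z. z \<in> B"] by blast
  with p assms obtain q where "as = x # q" by (cases as) auto
  then have "p = (x # q @ [z]) @ bs" using sp(1) by simp
  then have "successively (\<lambda>a b. (a, b) \<in> r) (x # q @ [z])"
    using p(5) by (metis successively_append_iff)
  moreover have "distinct (x # q)" using p(4) sp(1) \<open>as = x # q\<close> by simp
  moreover have "set (x # q) \<inter> B = {}" using sp(3) \<open>as = x # q\<close> by auto
  ultimately show ?thesis using sp(2) by blast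
qed

text \<open>The finite paths are nested prefixes, so they have an infinite path as their limit.
  \<open>P\<close> may record extra data that makes the next extension possible.\<close>

lemma infinite_path_of_growing_lists:
  assumes "P p0"
    and ext: "\<And>p. P p \<Longrightarrow> \<exists>q. q \<noteq> [] \<and> P (p @ q)"
    and P: "\<And>p. P p \<Longrightarrow> distinct p \<and> successively (\<lambda>a b. (a, b) \<in> arc_rel tail head F) p"
  shows "has_forward_infinite_path tail head F"
proof -
  obtain g where g: "\<And>n. P (g n)" "\<And>n. \<exists>q. q \<noteq> [] \<and> g (Suc n) = g n @ q"
  proof -
    obtain g where g: "\<forall>n. P (g n) \<and> (\<exists>q. q \<noteq> [] \<and> g (Suc n) = g n @ q)"
    proof (atomize_elim, rule dependent_nat_choice[of "\<lambda>_. P" "\<lambda>_ p p'. \<exists>q. q \<noteq> [] \<and> p' = p @ q"])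
      show "\<exists>p. P p" using assms(1) by blast
    next
      fix p and n :: nat assume "P p"
      then show "\<exists>p'. P p' \<and> (\<exists>q. q \<noteq> [] \<and> p' = p @ q)" using ext by blast
    qed
    show ?thesis by (rule that[of g]) (use g in simp_all)
  qed
  have len: "n \<le> length (g n)" for n
  proof (induction n)
    case (Suc n)
    obtain q where "q \<noteq> []" "g (Suc n) = g n @ q" using g(2) by blast
    with Suc show ?case by (cases q) auto
  qed simp
  have pref: "\<exists>q. g (n + d) = g n @ q" for n d
  proof (induction d)
    case (Suc d)
    with g(2)[of "n + d"] show ?case by auto
  qed simp
  \<comment> \<open>\<open>g (Suc m)\<close> already has an entry at position \<open>m\<close>, and
    later lists only append to it.\<close>
  have nth: "g n ! m = g (Suc m) ! m" if "m < n" for m n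
  proof -
    obtain q where "g (Suc m + (n - Suc m)) = g (Suc m) @ q" using pref by blast
    with that len[of "Suc m"] show ?thesis by (simp add: nth_append)
  qed
  define x where "x m = g (Suc m) ! m" for m
  have "inj x"
  proof (rule injI)
    fix a b assume "x a = x b"
    let ?n = "Suc (max a b)"
    have "g ?n ! a = g ?n ! b" using \<open>x a = x b\<close> nth[of a ?n] nth[of b ?n] by (simp add: x_def)
    moreover have "a < length (g ?n)" "b < length (g ?n)" using len[of ?n] by linarith+
    ultimately show "a = b" using P[OF g(1)[of ?n]] nth_eq_iff_index_eq by blast
  qed
  moreover have "\<exists>e\<in>F. tail e = x n \<and> head e = x (Suc n)" for n
  proof -
    have "(g (Suc (Suc n)) ! n, g (Suc (Suc n)) ! Suc n) \<in> arc_rel tail head F"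
      by (rule successively_nthD) (use P[OF g(1)] len[of "Suc (Suc n)"] in auto)
    then show ?thesis using nth[of n "Suc (Suc n)"] by (auto simp: x_def arc_rel_def)
  qed
  ultimately show ?thesis unfolding has_forward_infinite_path_def by blast
qed

section \<open>Growing a single branching\<close>

text \<open>The set counted by \<open>rho\<close>. Working with the set allows cardinalities in
  \<open>nat\<close>; an infinite in-degree satisfies every finite lower bound, whence the
  finiteness premises in the cut conditions below.\<close>

definition in_arcs :: "('e \<Rightarrow> 'v) \<Rightarrow> ('e \<Rightarrow> 'v) \<Rightarrow> 'e set \<Rightarrow> 'v set \<Rightarrow> 'e set" where
  "in_arcs tail head E X = {e \<in> E. tail e \<notin> X \<and> head e \<in> X}"

lemma enat_le_rho_iff:
  "enat n \<le> rho tail head E X \<longleftrightarrow> (finite (in_arcs tail head E X) \<longrightarrow> n \<le> card (in_arcs tail head E X))"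
  by (simp add: rho_def in_arcs_def Let_def)

text \<open>An arc entering the intersection or the union enters \<open>X\<close> or
  \<open>Y\<close>, and an arc counted twice on the left is counted twice on the right.\<close>

lemma card_in_arcs_submodular:
  assumes "finite (in_arcs tail head E X)" "finite (in_arcs tail head E Y)"
  shows "finite (in_arcs tail head E (X \<inter> Y))" "finite (in_arcs tail head E (X \<union> Y))"
    and "card (in_arcs tail head E (X \<inter> Y)) + card (in_arcs tail head E (X \<union> Y))
      \<le> card (in_arcs tail head E X) + card (in_arcs tail head E Y)"
proof -
  let ?d = "in_arcs tail head E"
  have sub: "?d (X \<inter> Y) \<union> ?d (X \<union> Y) \<subseteq> ?d X \<union> ?d Y" "?d (X \<inter> Y) \<inter> ?d (X \<union> Y) \<subseteq> ?d X \<inter> ?d Y"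
    by (auto simp: in_arcs_def)
  have "finite (?d (X \<inter> Y) \<union> ?d (X \<union> Y))"
    by (rule finite_subset[OF sub(1)]) (use assms in simp)
  then show fin: "finite (?d (X \<inter> Y))" "finite (?d (X \<union> Y))" by simp_all
  show "card (?d (X \<inter> Y)) + card (?d (X \<union> Y)) \<le> card (?d X) + card (?d Y)"
    unfolding card_Un_Int[OF assms] card_Un_Int[OF fin]
    by (intro add_mono card_mono sub) (use assms in auto)
qed

text \<open>Growth of one branching while the others stand still: \<open>f X\<close> stands for the
  number of other indices whose vertex set misses \<open>X\<close>, and \<open>E0\<close> for the
  arcs outside the given branchings.\<close>

locale root_growth =
  fixes tail head :: "'e \<Rightarrow> 'v" and V :: "'v set" and E0 :: "'e set" and f :: "'v set \<Rightarrow> nat"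
  assumes f_antimono: "X \<subseteq> Y \<Longrightarrow> f Y \<le> f X"
    and f_supermodular: "f X + f Y \<le> f (X \<inter> Y) + f (X \<union> Y)"
    and arcs_in: "\<And>e. e \<in> E0 \<Longrightarrow> tail e \<in> V"
    and no_ray: "\<not> has_forward_infinite_path tail head E0"
begin

abbreviation d :: "'e set \<Rightarrow> 'v set \<Rightarrow> 'e set" where
  "d \<equiv> in_arcs tail head"

definition valid :: "'e set \<times> 'v set \<Rightarrow> bool" where
  "valid = (\<lambda>(E, S). E \<subseteq> E0 \<and> (\<forall>X\<subseteq>V. X \<noteq> {} \<longrightarrow> finite (d E X) \<longrightarrow> f X + of_bool (X \<inter> S = {}) \<le> card (d E X)))"

lemma validD:
  assumes "valid (E, S)" "X \<subseteq> V" "X \<noteq> {}" "finite (d E X)"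
  shows "f X \<le> card (d E X)" "X \<inter> S = {} \<Longrightarrow> f X < card (d E X)"
proof -
  have "f X + of_bool (X \<inter> S = {}) \<le> card (d E X)" using assms unfolding valid_def prod.case by blast
  then show "f X \<le> card (d E X)" "X \<inter> S = {} \<Longrightarrow> f X < card (d E X)" by auto
qed

inductive step :: "'e set \<times> 'v set \<Rightarrow> 'e set \<times> 'v set \<Rightarrow> bool" where
  "e \<in> E \<Longrightarrow> tail e \<in> S \<Longrightarrow> head e \<notin> S \<Longrightarrow> valid (E - {e}, insert (head e) S) \<Longrightarrow>
   step (E, S) (E - {e}, insert (head e) S)"

lemma steps_mono:
  assumes "step\<^sup>*\<^sup>* s s'"
  shows "(\<forall>e. e \<in> fst s \<longrightarrow> e \<notin> fst s' \<longrightarrow> head e \<in> snd s') \<and>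
    (valid s \<longrightarrow> valid s')"
  using assms
proof induction
  case (step s' s'')
  from step(2,3) show ?case by cases auto
qed simp

section \<open>Tight sets\<close>

definition tight :: "'e set \<Rightarrow> 'v set \<Rightarrow> bool" where
  "tight E T \<longleftrightarrow> T \<subseteq> V \<and> T \<noteq> {} \<and> finite (d E T) \<and> card (d E T) = f T"

text \<open>A tight set has no slack: a step along an arc entering \<open>T\<close> would push the
  in-degree below \<open>f T\<close> and destroy validity.\<close>

lemma in_arcs_tight_steps:
  assumes "step\<^sup>*\<^sup>* s s'" "tight (fst s) T"
  shows "d (fst s') T = d (fst s) T"
  using assms
proof (induction)
  case (step s' s'')
  then have eq: "d (fst s') T = d (fst s) T" by blast
  have "d (fst s'') T = d (fst s') T"
    using step(2)
  proof cases
    case (1 e E S)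
    have sub: "d (E - {e}) T \<subseteq> d E T" by (auto simp: in_arcs_def)
    have T: "T \<subseteq> V" "T \<noteq> {}" "finite (d E T)" "card (d E T) = f T"
      using \<open>tight (fst s) T\<close> eq 1(1) by (auto simp: tight_def)
    have "card (d E T) \<le> card (d (E - {e}) T)"
      using validD(1)[OF 1(6) T(1,2)] finite_subset[OF sub T(3)] T(4) by simp
    then have "d (E - {e}) T = d E T" using card_seteq[OF T(3) sub] by blast
    then show ?thesis using 1 by simp
  qed
  with eq show ?case by simp
qed simp

lemma tight_steps:
  assumes "step\<^sup>*\<^sup>* s s'" "tight (fst s) T"
  shows "tight (fst s') T"
  using in_arcs_tight_steps[OF assms] assms(2) by (simp add: tight_def)

text \<open>Standard uncrossing: in-degree is submodular and \<open>f\<close> supermodular, while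
  validity bounds the in-degrees of intersection and union from below, so equality holds
  throughout.\<close>

lemma tight_Int:
  assumes "valid (E, S)" "tight E X" "tight E Y" "X \<inter> Y \<noteq> {}"
  shows "tight E (X \<inter> Y)"
proof -
  have X: "X \<subseteq> V" "finite (d E X)" "card (d E X) = f X"
    and Y: "Y \<subseteq> V" "finite (d E Y)" "card (d E Y) = f Y"
    using assms by (auto simp: tight_def)
  note sub = card_in_arcs_submodular[OF X(2) Y(2)]
  have "f (X \<inter> Y) \<le> card (d E (X \<inter> Y))"
    by (rule validD(1)[OF assms(1)]) (use sub X Y assms(4) in auto)
  moreover have "f (X \<union> Y) \<le> card (d E (X \<union> Y))"
    by (rule validD(1)[OF assms(1)]) (use sub X Y assms(4) in auto)
  ultimately have "card (d E (X \<inter> Y)) = f (X \<inter> Y)"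
    using sub(3) X(3) Y(3) f_supermodular[of X Y] by linarith
  then show ?thesis using sub(1) X(1) assms(4) by (auto simp: tight_def)
qed

text \<open>No arc leads from the reached part of \<open>T\<close> to the unreached part, and
  \<open>e\<close> itself ends in the reached part. A nonempty unreached part would thus have
  in-degree below \<open>f T\<close>, contrary to validity and antitonicity of
  \<open>f\<close>.\<close>

lemma tight_reachable_from_entry:
  assumes "valid (E, S)" "tight E T" "e \<in> d E T"
  shows "T \<subseteq> {w. (head e, w) \<in> (arc_rel tail head E \<inter> T \<times> T)\<^sup>*}" (is "_ \<subseteq> ?R")
proof (rule ccontr)
  assume "\<not> T \<subseteq> ?R"
  then have ne: "T - ?R \<noteq> {}" by auto
  have T: "T \<subseteq> V" "finite (d E T)" "card (d E T) = f T" using assms(2) by (auto simp: tight_def)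
  have sub: "d E (T - ?R) \<subseteq> d E T - {e}"
  proof
    fix g assume g: "g \<in> d E (T - ?R)"
    have "tail g \<notin> T"
    proof
      assume "tail g \<in> T"
      with g have "(head e, tail g) \<in> (arc_rel tail head E \<inter> T \<times> T)\<^sup>*" "(tail g, head g) \<in> arc_rel tail head E \<inter> T \<times> T"
        by (auto simp: in_arcs_def arc_rel_def)
      then have "head g \<in> ?R" by (simp add: rtrancl.rtrancl_into_rtrancl)
      with g show False by (auto simp: in_arcs_def)
    qed
    with g show "g \<in> d E T - {e}" by (auto simp: in_arcs_def)
  qed
  have "f T \<le> f (T - ?R)" by (rule f_antimono) auto
  also have "\<dots> \<le> card (d E (T - ?R))"
    using validD(1)[OF assms(1) _ ne] T sub by (meson Diff_subset finite_Diff finite_subset subset_trans)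
  also have "\<dots> \<le> card (d E T - {e})" using sub T by (simp add: card_mono)
  also have "\<dots> < card (d E T)" using assms(3) T by (meson card_Diff1_less)
  finally show False using T by simp
qed

section \<open>Descending tight sets around an unreachable vertex\<close>

definition bad :: "'e set \<times> 'v set \<Rightarrow> 'v \<Rightarrow> bool" where
  "bad s v \<longleftrightarrow> (\<forall>s'. step\<^sup>*\<^sup>* s s' \<longrightarrow> v \<notin> snd s')"

definition item :: "'e set \<times> 'v set \<Rightarrow> 'v set \<Rightarrow> bool" where
  "item s T \<longleftrightarrow> valid s \<and> tight (fst s) T \<and> (\<exists>v\<in>T. bad s v)"

definition later :: "'e set \<times> 'v set \<Rightarrow> 'v set \<Rightarrow> 'e set \<times> 'v set \<Rightarrow> 'v set \<Rightarrow> bool" where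
  "later s T s' T' \<longleftrightarrow> step\<^sup>*\<^sup>* s s' \<and> T' \<subseteq> T \<and> item s' T'"

lemma later_trans: "later s T s' T' \<Longrightarrow> later s' T' s'' T'' \<Longrightarrow> later s T s'' T''"
  unfolding later_def by auto

text \<open>Some path inside \<open>T\<close> leads from a reached vertex to the bad vertex
  \<open>v\<close>. Growing along it must get stuck at an arc whose head is bad; the set obstructing
  this arc, intersected with \<open>T\<close>, is the required smaller tight set.\<close>

lemma later_entered_from_inside:
  assumes "item s T"
  shows "\<exists>s' T' e. later s T s' T' \<and> e \<in> d (fst s') T' \<and> tail e \<in> T"
proof -
  obtain E S where s: "s = (E, S)" by (cases s)
  from assms s obtain v where v: "v \<in> T" "bad s v" and val: "valid (E, S)"
    and T: "tight E T" "T \<subseteq> V" "finite (d E T)" "card (d E T) = f T"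
    by (auto simp: item_def tight_def)
  let ?r = "arc_rel tail head E \<inter> T \<times> T"
  let ?Z = "{z \<in> T. (z, v) \<in> ?r\<^sup>*}"
  have sub: "d E ?Z \<subseteq> d E T"
  proof
    fix g assume g: "g \<in> d E ?Z"
    have "tail g \<notin> T"
    proof
      assume "tail g \<in> T"
      with g have "(tail g, head g) \<in> ?r" "(head g, v) \<in> ?r\<^sup>*"
        by (auto simp: in_arcs_def arc_rel_def)
      then have "tail g \<in> ?Z" using \<open>tail g \<in> T\<close> by (simp add: converse_rtrancl_into_rtrancl)
      with g show False by (auto simp: in_arcs_def)
    qed
    with g show "g \<in> d E T" by (auto simp: in_arcs_def)
  qed
  \<comment> \<open>\<open>?Z\<close> is entered by at most \<open>f T\<close> arcs, since only arcs
    entering \<open>T\<close> can enter it. If it missed \<open>S\<close>, validity would demand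
    more than \<open>f ?Z\<close>, which is at least \<open>f T\<close>.\<close>
  have "?Z \<inter> S \<noteq> {}"
  proof
    assume disj: "?Z \<inter> S = {}"
    have "?Z \<subseteq> V" "?Z \<noteq> {}" "finite (d E ?Z)" using T(2) v(1) finite_subset[OF sub T(3)] by auto
    then have "f ?Z < card (d E ?Z)" using validD(2)[OF val] disj by blast
    also have "\<dots> \<le> f T" using card_mono[OF T(3) sub] T(4) by simp
    also have "f T \<le> f ?Z" by (rule f_antimono) auto
    finally show False by simp
  qed
  then obtain w0 where w0: "w0 \<in> S" "(w0, v) \<in> ?r\<^sup>*" by auto
  \<comment> \<open>The state \<open>s'\<close> is generalised in the induction because reaching the
    next vertex of the path may take further steps.\<close>
  have "\<exists>s' T' e. later s T s' T' \<and> e \<in> d (fst s') T' \<and> tail e \<in> T"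
    if "(w, v) \<in> ?r\<^sup>*" "step\<^sup>*\<^sup>* s s'" "w \<in> snd s'" for w s'
    using that
  proof (induction arbitrary: s' rule: converse_rtrancl_induct)
    case base
    with v show ?case unfolding bad_def by blast
  next
    case (step w w')
    show ?case
    proof (cases "bad s' w'")
      case False
      then obtain s'' where "step\<^sup>*\<^sup>* s' s''" "w' \<in> snd s''" unfolding bad_def by blast
      with step show ?thesis by (meson rtranclp_trans)
    next
      case True
      obtain E' S' where s': "s' = (E', S')" by (cases s')
      from step(1) obtain e where e: "e \<in> E" "tail e = w" "head e = w'" "w \<in> T" "w' \<in> T"
        by (auto simp: arc_rel_def)
      have w': "w' \<notin> S'" using True s' unfolding bad_def by auto
      \<comment> \<open>Had \<open>e\<close> been used already, its head \<open>w'\<close> would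
        have been reached.\<close>
      have eE: "e \<in> E'" using steps_mono[OF step(4)] e w' s s' by auto
      have val': "valid (E', S')" using steps_mono[OF step(4)] val s s' by simp
      have "\<not> valid (E' - {e}, insert w' S')"
      proof
        assume "valid (E' - {e}, insert w' S')"
        then have "step s' (E' - {e}, insert w' S')"
          using step.intros[of e E' S'] eE e w' step(5) s' by simp
        with True show False unfolding bad_def by (metis insertI1 r_into_rtranclp snd_conv)
      qed
      moreover have "E' - {e} \<subseteq> E0" using val' by (auto simp: valid_def)
      ultimately obtain X where X: "X \<subseteq> V" "X \<noteq> {}" "finite (d (E' - {e}) X)"
        "card (d (E' - {e}) X) < f X + of_bool (X \<inter> insert w' S' = {})"
        unfolding valid_def prod.case by (meson not_le)
      have fin: "finite (d E' X)"
        by (rule finite_subset[of _ "insert e (d (E' - {e}) X)"]) (use X(3) in \<open>auto simp: in_arcs_def\<close>)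
      have eX: "e \<in> d E' X"
      proof (rule ccontr)
        assume "e \<notin> d E' X"
        then have "d (E' - {e}) X = d E' X" by (auto simp: in_arcs_def)
        then show False using validD[OF val' X(1,2) fin] X(4) by (auto simp: of_bool_def split: if_splits)
      qed
      then have "d (E' - {e}) X = d E' X - {e}" "w' \<in> X" "w \<notin> X" using e by (auto simp: in_arcs_def)
      \<comment> \<open>Since \<open>w'\<close> lies in \<open>X\<close>, the \<open>of_bool\<close>
        term of the violated bound is zero, so deleting the single arc \<open>e\<close> already
        drops the in-degree below \<open>f X\<close>.\<close>
      with X(4) eX fin have "card (d E' X) \<le> f X" by (auto simp: card_Diff_singleton)
      with validD(1)[OF val' X(1,2) fin] X fin have tX: "tight E' X" by (simp add: tight_def)
      have "tight E' (X \<inter> T)"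
        using tight_Int[OF val' tX, of T] tight_steps[OF step(4), of T] T(1) s s' \<open>w' \<in> X\<close> e by auto
      then have "item s' (X \<inter> T)" using True val' s' \<open>w' \<in> X\<close> e by (auto simp: item_def)
      then have "later s T s' (X \<inter> T)" using step(4) by (simp add: later_def)
      moreover have "e \<in> d (fst s') (X \<inter> T)" using eX s' e by (auto simp: in_arcs_def)
      ultimately show ?thesis using e by blast
    qed
  qed
  from this[OF w0(2), of s] w0 s show ?thesis by simp
qed

text \<open>An entering arc outside this set can be left behind: its head is missed by some later
  tight set that still contains a bad vertex.\<close>

definition locked :: "'e set \<times> 'v set \<Rightarrow> 'v set \<Rightarrow> 'e set" where
  "locked s T = {e \<in> d (fst s) T. \<forall>s' T'. later s T s' T' \<longrightarrow> head e \<in> T'}"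

text \<open>Tightness preserves the arcs entering \<open>T\<close>. A locked one keeps its head in
  \<open>T'\<close> and its tail outside, and whatever is later than \<open>T'\<close> is later than
  \<open>T\<close>.\<close>

lemma locked_later:
  assumes "item s T" "later s T s' T'"
  shows "locked s T \<subseteq> locked s' T'"
proof
  fix e assume e: "e \<in> locked s T"
  have "d (fst s') T = d (fst s) T"
    using assms by (intro in_arcs_tight_steps) (auto simp: later_def item_def)
  then have "e \<in> d (fst s') T" using e by (simp add: locked_def)
  then have "e \<in> d (fst s') T'" using e assms(2) unfolding locked_def in_arcs_def later_def by blast
  with e show "e \<in> locked s' T'" using later_trans[OF assms(2)] unfolding locked_def by blast
qed

text \<open>The bound \<open>f {}\<close> is the same for all states and sets, which is what makes a
  maximal number of locked arcs available in \<open>no_item\<close>.\<close>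

lemma locked_bounded:
  assumes "item s T"
  shows "finite (locked s T)" "card (locked s T) \<le> f {}"
proof -
  have fin: "finite (d (fst s) T)" "card (d (fst s) T) = f T" using assms by (auto simp: item_def tight_def)
  have sub: "locked s T \<subseteq> d (fst s) T" by (auto simp: locked_def)
  show "finite (locked s T)" using sub fin finite_subset by blast
  show "card (locked s T) \<le> f {}"
    using card_mono[OF fin(1) sub] f_antimono[of "{}" T] fin by simp
qed

text \<open>Start where the number of locked arcs is maximal. From then on every arc entering a
  later set from inside \<open>T0\<close> is unlocked, so its head can be escaped. Joining these
  escapes inside the shrinking tight sets gives a forward-infinite path.\<close>

lemma no_item: "\<not> item s T"
proof
  assume "item s T"
  let ?P = "\<lambda>(s, T). item s T" and ?m = "\<lambda>(s, T). card (locked s T)"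
  have "?P (s, T)" using \<open>item s T\<close> by simp
  moreover have "\<forall>q. ?P q \<longrightarrow> ?m q < Suc (f {})" using locked_bounded(2) by (auto simp: less_Suc_eq_le)
  ultimately have "\<exists>p. ?P p \<and> (\<forall>q. ?P q \<longrightarrow> ?m q \<le> ?m p)" by (rule ex_has_greatest_nat)
  then obtain s0 T0 where 0: "item s0 T0" and
    max: "\<And>s T. item s T \<Longrightarrow> card (locked s T) \<le> card (locked s0 T0)" by fast
  have locked_eq: "locked s T = locked s0 T0" if "later s0 T0 s T" for s T
    using locked_later[OF 0 that] max[of s T] locked_bounded(1)[of s T] that
    by (metis card_seteq later_def)
  \<comment> \<open>The finite path \<open>p\<close> ends at the head of an unlocked arc entering
    \<open>T\<close>, and its earlier vertices lie outside \<open>T\<close>. As all further vertices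
    are chosen in \<open>T\<close>, the path never meets itself.\<close>
  define Q where "Q p \<longleftrightarrow> distinct p \<and> successively (\<lambda>a b. (a, b) \<in> arc_rel tail head E0) p \<and>
    p \<noteq> [] \<and> (\<exists>s T e. later s0 T0 s T \<and> e \<in> d (fst s) T - locked s T \<and> head e = last p \<and>
      set (butlast p) \<inter> T = {})" for p
  obtain s1 T1 e1 where 1: "later s0 T0 s1 T1" "e1 \<in> d (fst s1) T1" "tail e1 \<in> T0"
    using later_entered_from_inside[OF 0] by blast
  \<comment> \<open>The locked arcs are still those of \<open>T0\<close>, so their tails lie outside
    \<open>T0\<close>. The same reason serves for \<open>g\<close> below, whose tail lies in
    \<open>T\<close>.\<close>
  have "e1 \<notin> locked s1 T1" using locked_eq[OF 1(1)] 1(3) by (auto simp: locked_def in_arcs_def)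
  with 1 have "\<exists>s T e. later s0 T0 s T \<and> e \<in> d (fst s) T - locked s T \<and> head e = head e1" by blast
  then have "Q [head e1]" unfolding Q_def by (simp del: split_paired_Ex)
  then have "has_forward_infinite_path tail head E0"
  proof (rule infinite_path_of_growing_lists)
    fix p assume "Q p"
    then obtain s T e where p: "distinct p" "successively (\<lambda>a b. (a, b) \<in> arc_rel tail head E0) p" "p \<noteq> []"
      and sT: "later s0 T0 s T" "e \<in> d (fst s) T" "e \<notin> locked s T" "head e = last p" "set (butlast p) \<inter> T = {}"
      unfolding Q_def by blast
    then obtain s' T' where l': "later s T s' T'" "head e \<notin> T'" unfolding locked_def by blast
    then have l0: "later s0 T0 s' T'" using later_trans sT by blast
    obtain E' S' where s': "s' = (E', S')" by (cases s')
    have st: "step\<^sup>*\<^sup>* s s'" "T' \<subseteq> T" "T' \<noteq> {}" "valid (E', S')" "tight (fst s) T"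
      using l' sT s' by (auto simp: later_def item_def tight_def)
    have tight': "tight E' T" "e \<in> d E' T"
      using tight_steps[OF st(1,5)] in_arcs_tight_steps[OF st(1,5)] sT s' by auto
    obtain y where y: "y \<in> T'" using st by auto
    let ?r = "arc_rel tail head E' \<inter> T \<times> T"
    have "(head e, y) \<in> ?r\<^sup>*"
      using tight_reachable_from_entry[OF st(4) tight'] y st by auto
    from rtrancl_path_to_set[OF this l'(2) y] obtain q z where
      q: "distinct (head e # q)" "set (head e # q) \<inter> T' = {}" "z \<in> T'"
        "successively (\<lambda>a b. (a, b) \<in> ?r) (head e # q @ [z])" by blast
    \<comment> \<open>Each of these vertices is followed by another one, hence is the source of a
      pair in \<open>?r\<close>.\<close>
    have qT: "set (head e # q) \<subseteq> T"
    proof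
      fix w assume "w \<in> set (head e # q)"
      then obtain i where "i < length (head e # q)" "(head e # q) ! i = w" by (metis in_set_conv_nth)
      then show "w \<in> T" using successively_nthD[OF q(4), of i]
        by (auto simp: nth_append nth_Cons split: if_splits nat.splits)
    qed
    have E'E0: "E' \<subseteq> E0" using st(4) by (simp add: valid_def)
    have p_eq: "p = butlast p @ [head e]" using p(3) sT(4) by simp
    have "successively (\<lambda>a b. (a, b) \<in> arc_rel tail head E0) (head e # q @ [z])"
      by (rule successively_mono[OF q(4)]) (use E'E0 in \<open>auto simp: arc_rel_def\<close>)
    then have succ: "successively (\<lambda>a b. (a, b) \<in> arc_rel tail head E0) (p @ q @ [z])"
      using p(2) p_eq sT(4) p(3) by (auto simp: successively_append_iff successively_Cons)
    let ?c = "last (head e # q)"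
    have "(?c, z) \<in> ?r"
      using q(4) by (cases q rule: rev_cases) (auto simp: successively_append_iff successively_Cons)
    then obtain g where g: "g \<in> E'" "tail g = ?c" "head g = z" by (auto simp: arc_rel_def)
    have "?c \<in> set (head e # q)" by (rule last_in_set) simp
    then have cT: "?c \<in> T" "?c \<notin> T'" using qT q(2) by blast+
    have gd: "g \<in> d (fst s') T'" using g cT q(3) s' by (auto simp: in_arcs_def)
    have "g \<notin> locked s' T'"
      using locked_eq[OF l0] cT g sT(1) by (auto simp: locked_def in_arcs_def later_def)
    moreover have "distinct (p @ q @ [z])"
    proof -
      have "distinct (butlast p)" "head e \<notin> set (butlast p)"
        using p(1) sT(5) qT by (auto simp: distinct_butlast)
      then have "distinct ((butlast p @ [head e]) @ q @ [z])"
        using q(1-3) qT sT(5) st(2) by auto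
      then show ?thesis using p_eq by simp
    qed
    moreover have "set (butlast (p @ q @ [z])) \<inter> T' = {}"
    proof -
      have "set (butlast (p @ q @ [z])) = set (butlast p) \<union> set (head e # q)"
        by (subst p_eq) (auto simp: butlast_append)
      then show ?thesis using sT(5) st(2) q(2) by auto
    qed
    ultimately have "Q (p @ q @ [z])" using succ l0 gd g unfolding Q_def by fastforce
    then show "\<exists>q. q \<noteq> [] \<and> Q (p @ q)" by (metis append_is_Nil_conv not_Cons_self2)
  qed (auto simp: Q_def)
  with no_ray show False by simp
qed

text \<open>No arc enters \<open>V\<close>, so validity makes \<open>V\<close> itself tight; a
  vertex that cannot be reached would turn it into an \<open>item\<close>.\<close>

lemma reach_by_steps:
  assumes "valid s" "v \<in> V"
  shows "\<exists>s'. step\<^sup>*\<^sup>* s s' \<and> v \<in> snd s'"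
proof -
  have "fst s \<subseteq> E0" using assms(1) by (auto simp: valid_def)
  then have "d (fst s) V = {}" using arcs_in by (auto simp: in_arcs_def)
  then have "tight (fst s) V"
    using validD(1)[of "fst s" "snd s" V] assms by (auto simp: tight_def)
  then show ?thesis using no_item[of s V] assms unfolding item_def bad_def by blast
qed

end

section \<open>Branchings and in-degrees\<close>

lemma und_rel_iff:
  "(a, b) \<in> und_rel tail head F \<longleftrightarrow>
    (\<exists>g\<in>F. tail g = a \<and> head g = b \<or> head g = a \<and> tail g = b)"
  by (auto simp: und_rel_def arc_rel_def)

lemma und_rel_rtrancl_sym:
  "(a, b) \<in> (und_rel tail head F)\<^sup>* \<Longrightarrow> (b, a) \<in> (und_rel tail head F)\<^sup>*"
proof -
  have "sym (und_rel tail head F)" by (auto simp: sym_def und_rel_def)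
  then show "(a, b) \<in> (und_rel tail head F)\<^sup>* \<Longrightarrow> (b, a) \<in> (und_rel tail head F)\<^sup>*"
    by (meson sym_rtrancl symD)
qed

lemma arc_rel_rtrancl_und_rel:
  "(a, b) \<in> (arc_rel tail head F)\<^sup>* \<Longrightarrow> (a, b) \<in> (und_rel tail head F)\<^sup>*"
  by (rule rtrancl_mono[THEN subsetD]) (auto simp: und_rel_def)

text \<open>A simple undirected path joining the ends of \<open>e\<close> without using
  \<open>e\<close> is closed by \<open>e\<close>. A loop is the case where the path is a single
  vertex.\<close>

lemma und_cycle_of_detour:
  assumes e: "e \<in> F" and detour: "(tail e, head e) \<in> (und_rel tail head (F - {e}))\<^sup>*"
  shows "und_cycle tail head F"
proof -
  let ?joins = "\<lambda>g a b. tail g = a \<and> head g = b \<or> head g = a \<and> tail g = b"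
  obtain p where p: "p \<noteq> []" "hd p = tail e" "last p = head e" "distinct p"
    "successively (\<lambda>a b. (a, b) \<in> und_rel tail head (F - {e})) p"
    using rtrancl_distinct_path[OF detour] by blast
  define n where "n = length p - 1"
  have len: "length p = Suc n" using p(1) by (simp add: n_def)
  define h where "h i = (SOME g. g \<in> F - {e} \<and> ?joins g (p ! i) (p ! Suc i))" for i
  have h: "h i \<in> F - {e}" "?joins (h i) (p ! i) (p ! Suc i)" if "i < n" for i
  proof -
    have "(p ! i, p ! Suc i) \<in> und_rel tail head (F - {e})"
      by (rule successively_nthD[OF p(5)]) (use that len in simp)
    then have "\<exists>g. g \<in> F - {e} \<and> ?joins g (p ! i) (p ! Suc i)" unfolding und_rel_iff by blast
    then have "h i \<in> F - {e} \<and> ?joins (h i) (p ! i) (p ! Suc i)" unfolding h_def by (rule someI_ex)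
    then show "h i \<in> F - {e}" "?joins (h i) (p ! i) (p ! Suc i)" by blast+
  qed
  have "inj_on h {..<n}"
  proof (rule inj_onI)
    fix i j assume ij: "i \<in> {..<n}" "j \<in> {..<n}" "h i = h j"
    \<comment> \<open>One arc joins only one unordered pair of vertices. As \<open>p\<close> is
      distinct, the swapped case would force \<open>i = Suc j\<close> and
      \<open>j = Suc i\<close>.\<close>
    have "p ! i = p ! j \<or> p ! i = p ! Suc j \<and> p ! Suc i = p ! j"
      using h(2)[of i] h(2)[of j] ij by auto
    with ij show "i = j" using p(4) len by (auto simp: nth_eq_iff_index_eq)
  qed
  then have dist: "distinct (map h [0..<n] @ [e])"
    using h(1) by (force simp: distinct_map atLeast0LessThan)
  have ends: "p ! 0 = tail e" "p ! n = head e"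
    using p(1-3) len by (auto simp: hd_conv_nth last_conv_nth)
  show ?thesis
    unfolding und_cycle_def
  proof (intro exI[of _ "map h [0..<n] @ [e]"] exI[of _ "p @ [tail e]"] conjI allI impI)
    show "distinct (map h [0..<n] @ [e])" by (rule dist)
    show "set (map h [0..<n] @ [e]) \<subseteq> F" using h(1) e by auto
    show "distinct (butlast (p @ [tail e]))" using p(4) by simp
    show "(p @ [tail e]) ! length (map h [0..<n] @ [e]) = (p @ [tail e]) ! 0"
      using ends len by (simp add: nth_append)
  next
    fix i assume "i < length (map h [0..<n] @ [e])"
    then consider "i < n" | "i = n" by fastforce
    then show "?joins ((map h [0..<n] @ [e]) ! i) ((p @ [tail e]) ! i) ((p @ [tail e]) ! Suc i)"
    proof cases
      case 1
      then show ?thesis using h(2)[of i] len by (auto simp: nth_append)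
    next
      case 2
      then show ?thesis using ends len by (auto simp: nth_append)
    qed
  qed (use len in auto)
qed

text \<open>Consider the part of the path after its last arc from \<open>G\<close>: it starts at
  \<open>h\<close>, or at \<open>r\<close> if no such arc occurs.\<close>

lemma rtrancl_avoiding_arcs_into:
  assumes "(r, w) \<in> (arc_rel tail head F)\<^sup>*" "\<And>g. g \<in> G \<Longrightarrow> head g = h"
  shows "(r, w) \<in> (und_rel tail head (F - G))\<^sup>* \<or> (h, w) \<in> (und_rel tail head (F - G))\<^sup>*"
  using assms(1)
proof (induction rule: rtrancl_induct)
  case (step y z)
  then obtain g where g: "g \<in> F" "tail g = y" "head g = z" by (auto simp: arc_rel_def)
  show ?case
  proof (cases "g \<in> G")
    case True
    then show ?thesis using assms(2) g by auto
  next
    case False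
    then have "(y, z) \<in> und_rel tail head (F - G)" using g by (auto simp: und_rel_iff)
    then show ?thesis using step(3) by (meson rtrancl.rtrancl_into_rtrancl)
  qed
qed simp

text \<open>Acyclicity makes every arc a bridge. With two arcs into one vertex, both tails would be
  linked to \<open>r\<close> without these arcs, and the second arc would complete a detour around
  the first. An arc into \<open>r\<close> is bypassed by the path from \<open>r\<close> to its
  tail.\<close>

lemma arborescence_unique_in_arc:
  assumes arb: "is_arborescence tail head W F r"
  shows "inj_on head F" "r \<notin> head ` F"
proof -
  have W: "tail e \<in> W" "head e \<in> W" if "e \<in> F" for e
    using arb that by (auto simp: is_arborescence_def is_digraph_def)
  have reach: "(r, w) \<in> (arc_rel tail head F)\<^sup>*" if "w \<in> W" for w
    using arb that by (auto simp: is_arborescence_def)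
  have bridge: "(tail e, head e) \<notin> (und_rel tail head (F - {e}))\<^sup>*" if "e \<in> F" for e
    using und_cycle_of_detour[of e F] arb that by (auto simp: is_arborescence_def)
  show "inj_on head F"
  proof (rule inj_onI, rule ccontr)
    fix e e' assume e: "e \<in> F" "e' \<in> F" "head e = head e'" "e \<noteq> e'"
    have mono: "(a, b) \<in> (und_rel tail head (F - {g}))\<^sup>*"
      if "(a, b) \<in> (und_rel tail head (F - {e, e'}))\<^sup>*" "g \<in> {e, e'}" for a b g
      using that(1) by (rule rtrancl_mono[THEN subsetD, rotated]) (use that(2) in \<open>auto simp: und_rel_def arc_rel_def\<close>)
    have root: "(r, tail g) \<in> (und_rel tail head (F - {e, e'}))\<^sup>*" if "g \<in> {e, e'}" for g
    proof -
      have "(r, tail g) \<in> (und_rel tail head (F - {e, e'}))\<^sup>* \<or> (head e, tail g) \<in> (und_rel tail head (F - {e, e'}))\<^sup>*"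
        by (rule rtrancl_avoiding_arcs_into[OF reach]) (use W that e in auto)
      moreover have "(head e, tail g) \<notin> (und_rel tail head (F - {e, e'}))\<^sup>*"
      proof
        assume "(head e, tail g) \<in> (und_rel tail head (F - {e, e'}))\<^sup>*"
        then have "(tail g, head e) \<in> (und_rel tail head (F - {g}))\<^sup>*"
          using und_rel_rtrancl_sym mono[OF _ that] by metis
        moreover have "g \<in> F" "head e = head g" using that e by auto
        ultimately show False using bridge[of g] by simp
      qed
      ultimately show ?thesis by blast
    qed
    have "(tail e, r) \<in> (und_rel tail head (F - {e}))\<^sup>*" "(r, tail e') \<in> (und_rel tail head (F - {e}))\<^sup>*"
      using und_rel_rtrancl_sym[OF mono[OF root, of e e]] mono[OF root, of e' e] by simp_all
    moreover have "(tail e', head e) \<in> und_rel tail head (F - {e})" using e by (auto simp: und_rel_iff)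
    ultimately have "(tail e, head e) \<in> (und_rel tail head (F - {e}))\<^sup>*"
      by (meson rtrancl.rtrancl_into_rtrancl rtrancl_trans)
    with bridge e show False by blast
  qed
  show "r \<notin> head ` F"
  proof
    assume "r \<in> head ` F"
    then obtain e where e: "e \<in> F" "head e = r" by auto
    \<comment> \<open>The two alternatives coincide because the common head of the avoided arcs is
      \<open>r\<close>.\<close>
    have "(r, tail e) \<in> (und_rel tail head (F - {e}))\<^sup>* \<or> (r, tail e) \<in> (und_rel tail head (F - {e}))\<^sup>*"
      by (rule rtrancl_avoiding_arcs_into[OF reach]) (use W e in auto)
    then have "(tail e, head e) \<in> (und_rel tail head (F - {e}))\<^sup>*"
      using e(2) und_rel_rtrancl_sym by metis
    with bridge[OF e(1)] show False by simp
  qed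
qed

section \<open>Branchings and root sets in terms of incoming arcs\<close>

lemma wcomp_arcs_wcomp:
  assumes "is_digraph tail head W F"
  shows "wcomp_arcs tail head F (wcomp tail head W F u) =
    {e \<in> F. head e \<in> wcomp tail head W F u}" "wcomp_arcs tail head F (wcomp tail head W F u) =
    {e \<in> F. tail e \<in> wcomp tail head W F u}"
proof -
  have "head e \<in> wcomp tail head W F u \<longleftrightarrow> tail e \<in> wcomp tail head W F u" if "e \<in> F" for e
  proof -
    have "(tail e, head e) \<in> und_rel tail head F" "(head e, tail e) \<in> und_rel tail head F"
      using that by (auto simp: und_rel_iff)
    moreover have "tail e \<in> W" "head e \<in> W" using assms that by (auto simp: is_digraph_def)
    ultimately show ?thesis unfolding wcomp_def by (auto intro: rtrancl.rtrancl_into_rtrancl)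
  qed
  then show "wcomp_arcs tail head F (wcomp tail head W F u) =
    {e \<in> F. head e \<in> wcomp tail head W F u}" "wcomp_arcs tail head F (wcomp tail head W F u) =
    {e \<in> F. tail e \<in> wcomp tail head W F u}"
    by (auto simp: wcomp_arcs_def)
qed

lemma branching_inj_on_head:
  assumes "is_branching tail head W F"
  shows "inj_on head F"
proof (rule inj_onI)
  fix e e' assume e: "e \<in> F" "e' \<in> F" "head e = head e'"
  have dig: "is_digraph tail head W F" using assms by (simp add: is_branching_def)
  let ?C = "wcomp tail head W F (head e)"
  have "head e \<in> W" using dig e by (auto simp: is_digraph_def)
  then obtain r where "is_arborescence tail head ?C (wcomp_arcs tail head F ?C) r"
    using assms by (auto simp: is_branching_def)
  from arborescence_unique_in_arc(1)[OF this] show "e = e'"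
    using e \<open>head e \<in> W\<close> unfolding wcomp_arcs_wcomp(1)[OF dig] by (auto simp: inj_on_def wcomp_def)
qed

lemma branching_component_root:
  assumes "is_branching tail head W F" "u \<in> W"
  shows "\<exists>r\<in>root_set tail head W F. (r, u) \<in> (arc_rel tail head F)\<^sup>*"
proof -
  let ?C = "wcomp tail head W F u"
  obtain r where r: "is_arborescence tail head ?C (wcomp_arcs tail head F ?C) r"
    using assms by (auto simp: is_branching_def)
  then have rC: "r \<in> ?C" by (simp add: is_arborescence_def)
  then have ur: "(u, r) \<in> (und_rel tail head F)\<^sup>*" by (simp add: wcomp_def)
  have "wcomp tail head W F r = ?C"
    using ur und_rel_rtrancl_sym[OF ur] by (auto simp: wcomp_def intro: rtrancl_trans)
  then have "r \<in> root_set tail head W F" using r rC by (simp add: root_set_def wcomp_def)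
  moreover have "(r, u) \<in> (arc_rel tail head (wcomp_arcs tail head F ?C))\<^sup>*"
    using r assms(2) by (auto simp: is_arborescence_def wcomp_def)
  then have "(r, u) \<in> (arc_rel tail head F)\<^sup>*"
    by (rule rtrancl_mono[THEN subsetD, rotated]) (auto simp: arc_rel_def wcomp_arcs_def)
  ultimately show ?thesis by blast
qed

text \<open>A root has no incoming arc in its component. Conversely, a vertex without incoming arc
  is reached from the root of its component only by the trivial path.\<close>

lemma root_set_branching:
  assumes "is_branching tail head W F"
  shows "root_set tail head W F = W - head ` F"
proof -
  have dig: "is_digraph tail head W F" using assms by (simp add: is_branching_def)
  have "r \<in> W - head ` F" if "r \<in> root_set tail head W F" for r
  proof -
    let ?C = "wcomp tail head W F r"
    have "r \<in> W" "is_arborescence tail head ?C (wcomp_arcs tail head F ?C) r"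
      using that by (auto simp: root_set_def)
    moreover have "r \<in> ?C" using \<open>r \<in> W\<close> by (simp add: wcomp_def)
    ultimately show ?thesis
      using arborescence_unique_in_arc(2)[of tail head ?C _ r] unfolding wcomp_arcs_wcomp(1)[OF dig] by auto
  qed
  moreover have "r \<in> root_set tail head W F" if "r \<in> W" "r \<notin> head ` F" for r
  proof -
    obtain r' where r': "r' \<in> root_set tail head W F" "(r', r) \<in> (arc_rel tail head F)\<^sup>*"
      using branching_component_root[OF assms \<open>r \<in> W\<close>] by blast
    from r'(2) have "r' = r"
      by (cases rule: rtranclE) (use that(2) in \<open>auto simp: arc_rel_def\<close>)
    with r'(1) show ?thesis by simp
  qed
  ultimately show ?thesis by blast
qed

text \<open>The distance from the sources strictly increases along every arc, which excludes
  undirected cycles; uniqueness of incoming arcs then makes each weak component reachable from a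
  single source.\<close>

lemma is_branchingI:
  assumes dig: "is_digraph tail head W F" and inj: "inj_on head F"
    and reach: "\<And>w. w \<in> W \<Longrightarrow> \<exists>r\<in>W - head ` F. (r, w) \<in> (arc_rel tail head F)\<^sup>*"
  shows "is_branching tail head W F"
proof -
  let ?a = "arc_rel tail head F"
  \<comment> \<open>As \<open>e\<close> is the only arc into its head, a walk from a source to
    \<open>head e\<close> must end with \<open>e\<close>.\<close>
  have pred: "\<exists>m. n = Suc m \<and> (r, tail e) \<in> ?a ^^ m"
    if e: "e \<in> F" and r: "r \<notin> head ` F" and n: "(r, head e) \<in> ?a ^^ n" for e r n
  proof (cases n)
    case 0
    then show ?thesis using e r n by auto
  next
    case (Suc m)
    then obtain g where "g \<in> F" "head g = head e" "(r, tail g) \<in> ?a ^^ m"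
      using n by (auto simp: arc_rel_def)
    moreover from this have "g = e" using inj e by (auto simp: inj_on_def)
    ultimately show ?thesis using Suc by auto
  qed
  define depth where "depth w = (LEAST n. \<exists>r\<in>W - head ` F. (r, w) \<in> ?a ^^ n)" for w
  have depth: "depth (tail e) < depth (head e)" if e: "e \<in> F" for e
  proof -
    have "head e \<in> W" using dig e by (auto simp: is_digraph_def)
    then have "\<exists>n. \<exists>r\<in>W - head ` F. (r, head e) \<in> ?a ^^ n"
      using reach by (metis rtrancl_imp_relpow)
    then have "\<exists>r\<in>W - head ` F. (r, head e) \<in> ?a ^^ depth (head e)"
      unfolding depth_def by (rule LeastI_ex)
    then obtain r where r: "r \<in> W - head ` F" "(r, head e) \<in> ?a ^^ depth (head e)" by blast
    then obtain m where m: "depth (head e) = Suc m" "(r, tail e) \<in> ?a ^^ m"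
      using pred[OF e, of r] by blast
    then have "depth (tail e) \<le> m" unfolding depth_def using r(1) by (intro Least_le) blast
    with m show ?thesis by simp
  qed
  have acyclic: "\<not> und_cycle tail head G" if "G \<subseteq> F" for G
  proof
    assume "und_cycle tail head G"
    then obtain es vs where c: "length es \<ge> 1" "length vs = Suc (length es)" "distinct es" "set es \<subseteq> G"
      "vs ! length es = vs ! 0" "distinct (butlast vs)"
      "\<And>i. i < length es \<Longrightarrow> (tail (es ! i) = vs ! i \<and> head (es ! i) = vs ! Suc i) \<or>
          (head (es ! i) = vs ! i \<and> tail (es ! i) = vs ! Suc i)"
      unfolding und_cycle_def by blast
    let ?B = "set (butlast vs)"
    have mem: "vs ! i \<in> ?B" if "i \<le> length es" for i
    proof (cases "i = length es")
      case True
      have pos: "0 < length (butlast vs)" using c(1,2) by (metis One_nat_def diff_Suc_1 length_butlast less_eq_Suc_le)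
      have "vs ! i = butlast vs ! 0" using True c(5) nth_butlast[OF pos] by simp
      then show ?thesis using nth_mem[OF pos] by simp
    next
      case False
      then have "vs ! i = butlast vs ! i" "i < length (butlast vs)" using c(2) that by (simp_all add: nth_butlast)
      then show ?thesis by simp
    qed
    have ends: "tail e \<in> ?B" "head e \<in> ?B" if "e \<in> set es" for e
    proof -
      obtain i where i: "i < length es" "es ! i = e" using \<open>e \<in> set es\<close> by (auto simp: in_set_conv_nth)
      then show "tail e \<in> ?B" "head e \<in> ?B" using c(7)[OF i(1)] mem[of i] mem[of "Suc i"] by auto
    qed
    \<comment> \<open>A cycle has as many vertices as arcs, so by injectivity each of its vertices is the head of one of its arcs.\<close>
    have "card (head ` set es) = card ?B"
      using card_image[OF inj_on_subset[OF inj]] c(2-4,6) that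
      by (metis One_nat_def diff_Suc_1 distinct_card length_butlast subset_trans)
    then have heads: "head ` set es = ?B" using ends by (intro card_subset_eq) auto
    have "?B \<noteq> {}" using mem[of 0] by auto
    then obtain v where v: "v \<in> ?B" "\<And>w. w \<in> ?B \<Longrightarrow> depth v \<le> depth w"
      using ex_min_if_finite[of "depth ` ?B"] by (metis (mono_tags) List.finite_set arg_min_if_finite(1) arg_min_least)
    then obtain e where e: "e \<in> set es" "head e = v" using heads by (metis imageE)
    then have "depth (tail e) < depth v" using depth[of e] c(4) that by auto
    with v(2)[of "tail e"] ends e show False by auto
  qed
  have "\<exists>r. is_arborescence tail head (wcomp tail head W F u)
      (wcomp_arcs tail head F (wcomp tail head W F u)) r" if u: "u \<in> W" for u
  proof -
    let ?C = "wcomp tail head W F u"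
    let ?G = "wcomp_arcs tail head F ?C"
    obtain r where r: "r \<in> W" "r \<notin> head ` F" "(r, u) \<in> ?a\<^sup>*" using reach[OF u] by auto
    \<comment> \<open>Reachability from \<open>r\<close> also passes backwards over an arc, by
      \<open>pred\<close>, so it spreads through the whole weak component.\<close>
    have all: "(r, w) \<in> ?a\<^sup>*" if "(u, w) \<in> (und_rel tail head F)\<^sup>*" for w
      using that
    proof (induction rule: rtrancl_induct)
      case (step y z)
      then obtain g where g: "g \<in> F" "tail g = y \<and> head g = z \<or> head g = y \<and> tail g = z"
        by (auto simp: und_rel_iff)
      show ?case
      proof (cases "tail g = y")
        case True
        then have "y = z \<or> (y, z) \<in> ?a" using g by (auto simp: arc_rel_def)
        then show ?thesis using step(3) by (auto intro: rtrancl.rtrancl_into_rtrancl)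
      next
        case False
        then have "head g = y" "tail g = z" using g by auto
        then obtain n where "(r, head g) \<in> ?a ^^ n" using step(3) by (metis rtrancl_imp_relpow)
        then show ?thesis using pred[OF g(1) r(2)] \<open>tail g = z\<close> by (metis relpow_imp_rtrancl)
      qed
    qed (use r in simp)
    have ru: "(u, r) \<in> (und_rel tail head F)\<^sup>*"
      using und_rel_rtrancl_sym[OF arc_rel_rtrancl_und_rel[OF r(3)]] .
    then have rC: "r \<in> ?C" using r(1) by (simp add: wcomp_def)
    have G: "(r, w) \<in> (arc_rel tail head ?G)\<^sup>* \<and> w \<in> ?C" if "(r, w) \<in> ?a\<^sup>*" for w
      using that
    proof (induction rule: rtrancl_induct)
      case (step y z)
      then obtain g where g: "g \<in> F" "tail g = y" "head g = z" by (auto simp: arc_rel_def)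
      then have "g \<in> ?G" using step(3) unfolding wcomp_arcs_wcomp(2)[OF dig] by auto
      then have "(y, z) \<in> arc_rel tail head ?G" "z \<in> ?C" using g by (auto simp: arc_rel_def wcomp_arcs_def)
      then show ?case using step(3) by (auto intro: rtrancl.rtrancl_into_rtrancl)
    qed (use rC in simp)
    have reachC: "(r, w) \<in> (arc_rel tail head ?G)\<^sup>*" if "w \<in> ?C" for w
      using G all that by (auto simp: wcomp_def)
    have "is_arborescence tail head ?C ?G r"
      unfolding is_arborescence_def
    proof (intro conjI ballI)
      show "is_digraph tail head ?C ?G" by (auto simp: is_digraph_def wcomp_arcs_def)
      show "r \<in> ?C" by (rule rC)
      show "\<not> und_cycle tail head ?G" by (rule acyclic) (auto simp: wcomp_arcs_def)
      show "(r, w) \<in> (arc_rel tail head ?G)\<^sup>*" if "w \<in> ?C" for w using reachC that .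
      show "(x, y) \<in> (und_rel tail head ?G)\<^sup>*" if "x \<in> ?C" "y \<in> ?C" for x y
        using und_rel_rtrancl_sym[OF arc_rel_rtrancl_und_rel[OF reachC[OF that(1)]]]
          arc_rel_rtrancl_und_rel[OF reachC[OF that(2)]] by (rule rtrancl_trans)
    qed
    then show ?thesis by blast
  qed
  with dig show ?thesis by (simp add: is_branching_def)
qed

section \<open>Extending all branchings simultaneously\<close>

lemma card_disjoint_antimono:
  assumes "finite I" "X \<subseteq> Y"
  shows "card {j \<in> I. W j \<inter> Y = {}} \<le> card {j \<in> I. W j \<inter> X = {}}"
  by (rule card_mono) (use assms in auto)

text \<open>A set missing \<open>X\<close> or \<open>Y\<close> misses their intersection, and a set
  missing both misses their union.\<close>

lemma card_disjoint_supermodular: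
  assumes "finite I"
  shows "card {j \<in> I. W j \<inter> X = {}} + card {j \<in> I. W j \<inter> Y = {}}
    \<le> card {j \<in> I. W j \<inter> (X \<inter> Y) = {}} + card {j \<in> I. W j \<inter> (X \<union> Y) = {}}"
proof -
  let ?A = "\<lambda>X. {j \<in> I. W j \<inter> X = {}}"
  have fin: "finite (?A X)" for X using assms by simp
  have "card (?A X) + card (?A Y) = card (?A X \<union> ?A Y) + card (?A X \<inter> ?A Y)"
    by (rule card_Un_Int) (use fin in auto)
  also have "\<dots> \<le> card (?A (X \<inter> Y)) + card (?A (X \<union> Y))"
    by (intro add_mono card_mono fin) auto
  finally show ?thesis .
qed

locale branching_cover =
  fixes tail head :: "'e \<Rightarrow> 'v" and V :: "'v set" and E0 :: "'e set" and k :: nat and Vs :: "nat \<Rightarrow> 'v set"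
  assumes arcs_in: "\<And>e. e \<in> E0 \<Longrightarrow> tail e \<in> V \<and> head e \<in> V"
    and Vs_in: "\<And>i. i < k \<Longrightarrow> Vs i \<subseteq> V"
    and no_ray: "\<not> has_forward_infinite_path tail head E0"
    and cover: "\<And>X. X \<subseteq> V \<Longrightarrow> X \<noteq> {} \<Longrightarrow> finite (in_arcs tail head E0 X) \<Longrightarrow>
      card {i \<in> {..<k}. Vs i \<inter> X = {}} \<le> card (in_arcs tail head E0 X)"
begin

text \<open>A pair \<open>(i, e)\<close> in \<open>F\<close> assigns the arc \<open>e\<close> to
  branching \<open>i\<close>. With this encoding extension is inclusion and limits are
  unions.\<close>

definition reached :: "(nat \<times> 'e) set \<Rightarrow> nat \<Rightarrow> 'v set" where
  "reached F i = Vs i \<union> head ` (F `` {i})"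

definition rest :: "(nat \<times> 'e) set \<Rightarrow> 'e set" where
  "rest F = E0 - snd ` F"

text \<open>The heads assigned to \<open>i\<close> avoid \<open>Vs i\<close>, so no root of the
  given branching acquires an incoming arc.\<close>

definition partial :: "(nat \<times> 'e) set \<Rightarrow> bool" where
  "partial F \<longleftrightarrow> F \<subseteq> {..<k} \<times> E0 \<and> inj_on snd F \<and>
    (\<forall>i. inj_on head (F `` {i}) \<and> head ` (F `` {i}) \<inter> Vs i = {} \<and>
      (\<forall>w\<in>reached F i. \<exists>s\<in>Vs i. (s, w) \<in> (arc_rel tail head (F `` {i}))\<^sup>*))"

definition covered :: "(nat \<times> 'e) set \<Rightarrow> bool" where
  "covered F \<longleftrightarrow> (\<forall>X\<subseteq>V. X \<noteq> {} \<longrightarrow> finite (in_arcs tail head (rest F) X) \<longrightarrow>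
    card {i \<in> {..<k}. reached F i \<inter> X = {}} \<le> card (in_arcs tail head (rest F) X))"

definition full :: "(nat \<times> 'e) set \<Rightarrow> bool" where
  "full F \<longleftrightarrow> (\<forall>(i, e)\<in>F. \<forall>j<k. head e \<in> reached F j)"

lemma reached_mono: "F \<subseteq> F' \<Longrightarrow> reached F i \<subseteq> reached F' i"
  by (auto simp: reached_def)

text \<open>If some index still misses \<open>X\<close>, fullness means that no used arc has entered \<open>X\<close>.\<close>
lemma covered_if_full:
  assumes "full F"
  shows "covered F"
  unfolding covered_def
proof (intro allI impI)
  fix X assume X: "X \<subseteq> V" "X \<noteq> {}" "finite (in_arcs tail head (rest F) X)"
  show "card {i \<in> {..<k}. reached F i \<inter> X = {}} \<le> card (in_arcs tail head (rest F) X)"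
  proof (cases "{i \<in> {..<k}. reached F i \<inter> X = {}} = {}")
    case True
    then show ?thesis by (simp only: card.empty)
  next
    case False
    then obtain j where "j < k" "reached F j \<inter> X = {}" by auto
    then have "in_arcs tail head (rest F) X = in_arcs tail head E0 X"
      using assms by (fastforce simp: in_arcs_def rest_def full_def)
    moreover have "card {i \<in> {..<k}. reached F i \<inter> X = {}} \<le> card {i \<in> {..<k}. Vs i \<inter> X = {}}"
      by (rule card_mono) (auto simp: reached_def)
    ultimately show ?thesis using cover[OF X(1,2)] X(3) by simp
  qed
qed

text \<open>Injectivity concerns two assigned arcs at a time, and a reaching path persists in larger
  assignments. \<open>covered\<close> is not passed to the union directly; limits recover it through
  \<open>full\<close>.\<close>

lemma partial_Union:
  assumes chain: "\<And>A B. A \<in> C \<Longrightarrow> B \<in> C \<Longrightarrow> A \<subseteq> B \<or> B \<subseteq> A"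
    and part: "\<And>A. A \<in> C \<Longrightarrow> partial A" and ne: "C \<noteq> {}"
  shows "partial (\<Union>C)"
proof -
  have common: "\<exists>A\<in>C. x \<in> A \<and> y \<in> A" if xy: "x \<in> \<Union>C" "y \<in> \<Union>C" for x y
  proof -
    obtain A B where "A \<in> C" "x \<in> A" "B \<in> C" "y \<in> B" using xy by blast
    with chain[of A B] show ?thesis by blast
  qed
  have "\<Union>C \<subseteq> {..<k} \<times> E0" using part unfolding partial_def by blast
  moreover have "inj_on snd (\<Union>C)"
  proof (rule inj_onI)
    fix x y assume "x \<in> \<Union>C" "y \<in> \<Union>C" and eq: "snd x = snd y"
    then obtain A where "A \<in> C" "x \<in> A" "y \<in> A" using common by blast
    with part[of A] eq show "x = y" by (auto simp: partial_def dest: inj_onD)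
  qed
  moreover have "inj_on head ((\<Union>C) `` {i})" for i
  proof (rule inj_onI)
    fix x y assume "x \<in> (\<Union>C) `` {i}" "y \<in> (\<Union>C) `` {i}" and eq: "head x = head y"
    then have "(i, x) \<in> \<Union>C" "(i, y) \<in> \<Union>C" by auto
    then obtain A where A: "A \<in> C" "(i, x) \<in> A" "(i, y) \<in> A" using common by blast
    then have "inj_on head (A `` {i})" using part by (simp add: partial_def)
    then show "x = y" by (rule inj_onD) (use A eq in auto)
  qed
  moreover have "head ` ((\<Union>C) `` {i}) \<inter> Vs i = {}" for i
  proof -
    have "head ` (A `` {i}) \<inter> Vs i = {}" if "A \<in> C" for A using part[OF that] by (simp add: partial_def)
    then show ?thesis by blast
  qed
  moreover have "\<exists>s\<in>Vs i. (s, w) \<in> (arc_rel tail head ((\<Union>C) `` {i}))\<^sup>*" if w: "w \<in> reached (\<Union>C) i" for i w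
  proof -
    obtain A where A: "A \<in> C" "w \<in> reached A i" using w ne unfolding reached_def by blast
    then obtain s where "s \<in> Vs i" "(s, w) \<in> (arc_rel tail head (A `` {i}))\<^sup>*"
      using part unfolding partial_def by blast
    moreover have "(arc_rel tail head (A `` {i}))\<^sup>* \<subseteq> (arc_rel tail head ((\<Union>C) `` {i}))\<^sup>*"
      by (rule rtrancl_mono) (use A in \<open>auto simp: arc_rel_def\<close>)
    ultimately show ?thesis by blast
  qed
  ultimately show ?thesis unfolding partial_def by blast
qed

lemma full_Union: "(\<And>A. A \<in> C \<Longrightarrow> full A) \<Longrightarrow> full (\<Union>C)"
  by (fastforce simp: full_def dest: subsetD[OF reached_mono[OF Union_upper]])

text \<open>This translates one growth step of index \<open>i\<close> into the assignment
  \<open>F\<close>.\<close>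

lemma partial_insert:
  assumes F: "partial F" and i: "i < k" and e: "e \<in> rest F" "tail e \<in> reached F i" "head e \<notin> reached F i"
  shows "partial (insert (i, e) F)" "rest (insert (i, e) F) = rest F - {e}"
    "reached (insert (i, e) F) i = insert (head e) (reached F i)"
    "j \<noteq> i \<Longrightarrow> reached (insert (i, e) F) j = reached F j"
proof -
  let ?F = "insert (i, e) F"
  have imi: "?F `` {i} = insert e (F `` {i})" by auto
  have imj: "?F `` {j} = F `` {j}" if "j \<noteq> i" for j using that by auto
  show "rest ?F = rest F - {e}" by (auto simp: rest_def)
  show ri: "reached ?F i = insert (head e) (reached F i)" unfolding reached_def imi by auto
  show rj: "j \<noteq> i \<Longrightarrow> reached ?F j = reached F j" for j unfolding reached_def using imj by auto
  have reach: "\<exists>s\<in>Vs j. (s, w) \<in> (arc_rel tail head (?F `` {j}))\<^sup>*" if w: "w \<in> reached ?F j" for j w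
  proof -
    have old: "\<exists>s\<in>Vs j. (s, w) \<in> (arc_rel tail head (?F `` {j}))\<^sup>*" if w: "w \<in> reached F j" for w
    proof -
      obtain s where "s \<in> Vs j" "(s, w) \<in> (arc_rel tail head (F `` {j}))\<^sup>*"
        using F w unfolding partial_def by blast
      moreover have "(arc_rel tail head (F `` {j}))\<^sup>* \<subseteq> (arc_rel tail head (?F `` {j}))\<^sup>*"
        by (rule rtrancl_mono) (auto simp: arc_rel_def)
      ultimately show ?thesis by blast
    qed
    show ?thesis
    proof (cases "w \<in> reached F j")
      case False
      then have ji: "j = i" "w = head e" using w ri rj[of j] by auto
      then obtain s where "s \<in> Vs j" "(s, tail e) \<in> (arc_rel tail head (?F `` {j}))\<^sup>*"
        using old[of "tail e"] e by auto
      moreover have "(tail e, w) \<in> arc_rel tail head (?F `` {j})" using ji by (auto simp: arc_rel_def)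
      ultimately show ?thesis by (meson rtrancl.rtrancl_into_rtrancl)
    qed (use old in blast)
  qed
  have inj: "inj_on head (?F `` {j})" "head ` (?F `` {j}) \<inter> Vs j = {}" for j
    using F e(3) by (cases "j = i"; force simp: partial_def imi imj reached_def)+
  have "?F \<subseteq> {..<k} \<times> E0" "inj_on snd ?F"
    using F i e(1) by (auto simp: partial_def rest_def)
  with reach inj show "partial ?F" unfolding partial_def by blast
qed

lemma extend_to_vertex:
  assumes F: "partial F" "covered F" and i: "i < k" and v: "v \<in> V"
  shows "\<exists>F'. F \<subseteq> F' \<and> finite (F' - F) \<and> partial F' \<and> covered F' \<and> v \<in> reached F' i"
proof -
  define I where "I = {..<k} - {i}"
  have fI: "finite I" by (simp add: I_def)
  \<comment> \<open>Only index \<open>i\<close> will grow, so the sets reached by the other indices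
    can be frozen at \<open>F\<close>.\<close>
  define f where "f X = card {j \<in> I. reached F j \<inter> X = {}}" for X
  interpret rg: root_growth tail head V E0 f
  proof
    show "X \<subseteq> Y \<Longrightarrow> f Y \<le> f X" for X Y unfolding f_def by (rule card_disjoint_antimono[OF fI])
    show "f X + f Y \<le> f (X \<inter> Y) + f (X \<union> Y)" for X Y unfolding f_def by (rule card_disjoint_supermodular[OF fI])
  qed (use arcs_in no_ray in auto)
  have split: "card {j \<in> {..<k}. W j \<inter> X = {}} = f X + of_bool (X \<inter> W i = {})"
    if "\<And>j. j \<noteq> i \<Longrightarrow> W j = reached F j" for W X
  proof -
    have "{j \<in> {..<k}. W j \<inter> X = {}} = {j \<in> I. reached F j \<inter> X = {}} \<union> {j. j = i \<and> X \<inter> W i = {}}"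
    proof (rule set_eqI)
      fix j
      show "j \<in> {j \<in> {..<k}. W j \<inter> X = {}} \<longleftrightarrow> j \<in> {j \<in> I. reached F j \<inter> X = {}} \<union> {j. j = i \<and> X \<inter> W i = {}}"
        using that[of j] i by (cases "j = i") (simp_all add: I_def Int_commute)
    qed
    also have "card \<dots> = f X + of_bool (X \<inter> W i = {})"
      unfolding f_def by (subst card_Un_disjoint) (auto simp: I_def)
    finally show ?thesis .
  qed
  have covered_iff: "covered F' \<longleftrightarrow> rg.valid (rest F', reached F' i)"
    if eq: "\<forall>j. j \<noteq> i \<longrightarrow> reached F' j = reached F j" for F'
  proof -
    have "card {j \<in> {..<k}. reached F' j \<inter> X = {}} = f X + of_bool (X \<inter> reached F' i = {})" for X
      by (rule split) (use eq in simp)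
    then show ?thesis unfolding covered_def rg.valid_def prod.case by (simp add: rest_def)
  qed
  \<comment> \<open>Every state met during the growth is realised by an assignment differing from
    \<open>F\<close> in finitely many pairs, all of index \<open>i\<close>.\<close>
  have track: "\<exists>F'. F \<subseteq> F' \<and> finite (F' - F) \<and> partial F' \<and> (\<forall>j. j \<noteq> i \<longrightarrow> reached F' j = reached F j) \<and>
      s = (rest F', reached F' i)" if "rg.step\<^sup>*\<^sup>* (rest F, reached F i) s" for s
    using that
  proof induction
    case base
    show ?case using F(1) by (intro exI[of _ F]) simp
  next
    case (step s s')
    then obtain F' where F': "F \<subseteq> F'" "finite (F' - F)" "partial F'" "\<And>j. j \<noteq> i \<Longrightarrow> reached F' j = reached F j"
      "s = (rest F', reached F' i)" by blast
    from step(2) F'(5) obtain e where e: "e \<in> rest F'" "tail e \<in> reached F' i" "head e \<notin> reached F' i"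
      "s' = (rest F' - {e}, insert (head e) (reached F' i))" by (auto elim: rg.step.cases)
    have "insert (i, e) F' - F \<subseteq> insert (i, e) (F' - F)" by auto
    then have "finite (insert (i, e) F' - F)" using F'(2) finite_subset by blast
    then show ?case
      using partial_insert[OF F'(3) i e(1-3)] F' e(4) by (intro exI[of _ "insert (i, e) F'"]) auto
  qed
  have valid: "rg.valid (rest F, reached F i)" using covered_iff[of F] F(2) by simp
  from rg.reach_by_steps[OF valid v] obtain s where s: "rg.step\<^sup>*\<^sup>* (rest F, reached F i) s" "v \<in> snd s" by blast
  from track[OF s(1)] obtain F' where F': "F \<subseteq> F'" "finite (F' - F)" "partial F'"
    "\<forall>j. j \<noteq> i \<longrightarrow> reached F' j = reached F j" "s = (rest F', reached F' i)" by blast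
  have "rg.valid s" using rg.steps_mono[OF s(1)] valid by blast
  then have "covered F'" using covered_iff[OF F'(4)] F'(5) by simp
  with F' s(2) show ?thesis by auto
qed

lemma extend_to_finite_set:
  assumes "finite Y" "Y \<subseteq> {..<k} \<times> V" "partial F" "covered F"
  shows "\<exists>F'. F \<subseteq> F' \<and> finite (F' - F) \<and> partial F' \<and> covered F' \<and> (\<forall>(j, y)\<in>Y. y \<in> reached F' j)"
  using assms(1,2)
proof (induction Y rule: finite_induct)
  case empty
  show ?case using assms(3,4) by (intro exI[of _ F]) simp
next
  case (insert a Y)
  obtain j y where a: "a = (j, y)" by (cases a)
  from insert obtain F' where F': "F \<subseteq> F'" "finite (F' - F)" "partial F'" "covered F'"
    "\<forall>(j, y)\<in>Y. y \<in> reached F' j" by auto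
  obtain F'' where F'': "F' \<subseteq> F''" "finite (F'' - F')" "partial F''" "covered F''" "y \<in> reached F'' j"
    using extend_to_vertex[OF F'(3,4), of j y] insert.prems a by auto
  have "F'' - F \<subseteq> (F'' - F') \<union> (F' - F)" by auto
  then have "finite (F'' - F)" using F'(2) F''(2) by (meson finite_UnI finite_subset)
  moreover have "\<forall>(j, y)\<in>insert a Y. y \<in> reached F'' j"
    using F'(5) F''(5) a reached_mono[OF F''(1)] by blast
  ultimately show ?case using F'(1) F'' by blast
qed

text \<open>Each stage adds finitely many arcs, hence creates finitely many new heads; the next
  stage brings these into all branchings. The union of countably many stages is full.\<close>

lemma extend_full:
  assumes F: "partial F" "full F" and v: "v \<in> V"
  shows "\<exists>F'. F \<subseteq> F' \<and> partial F' \<and> full F' \<and> (\<forall>j<k. v \<in> reached F' j)"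
proof -
  define P where "P G \<longleftrightarrow> F \<subseteq> G \<and> finite (G - F) \<and> partial G \<and> covered G" for G
  define R where "R G G' \<longleftrightarrow> G \<subseteq> G' \<and> (\<forall>j<k. \<forall>y\<in>insert v (head ` snd ` (G - F)). y \<in> reached G' j)" for G G'
  have ext: "\<exists>G'. P G' \<and> R G G'" if "P G" for G
  proof -
    have G: "F \<subseteq> G" "finite (G - F)" "partial G" "covered G" using that by (auto simp: P_def)
    let ?Y = "{..<k} \<times> insert v (head ` snd ` (G - F))"
    have "?Y \<subseteq> {..<k} \<times> V" using G(3) v arcs_in by (fastforce simp: partial_def)
    moreover have "finite ?Y" using G(2) by simp
    ultimately obtain G' where G': "G \<subseteq> G'" "finite (G' - G)" "partial G'" "covered G'"
      "\<forall>(j, y)\<in>?Y. y \<in> reached G' j"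
      using extend_to_finite_set[OF _ _ G(3,4), of ?Y] by blast
    have "G' - F \<subseteq> (G' - G) \<union> (G - F)" by auto
    then have "finite (G' - F)" using G(2) G'(2) by (meson finite_UnI finite_subset)
    then have "P G'" using G(1) G' by (auto simp: P_def)
    moreover have "R G G'" using G'(1,5) by (auto simp: R_def)
    ultimately show ?thesis by blast
  qed
  have "P F" using F covered_if_full by (simp add: P_def)
  have "\<exists>g. \<forall>n::nat. P (g n) \<and> R (g n) (g (Suc n))"
    by (rule dependent_nat_choice[of "\<lambda>_. P" "\<lambda>_. R"]) (use \<open>P F\<close> ext in blast)+
  then obtain g where g: "\<And>n. P (g n)" "\<And>n. R (g n) (g (Suc n))" by blast
  let ?F = "\<Union>(range g)"
  have mono: "m \<le> n \<Longrightarrow> g m \<subseteq> g n" for m n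
    by (rule lift_Suc_mono_le[of g]) (use g(2) in \<open>auto simp: R_def\<close>)
  have part: "partial ?F"
  proof (rule partial_Union)
    fix A B assume "A \<in> range g" "B \<in> range g"
    then show "A \<subseteq> B \<or> B \<subseteq> A" using mono by (metis imageE nle_le)
  qed (use g(1) in \<open>auto simp: P_def\<close>)
  have sub: "F \<subseteq> ?F" using g(1)[of 0] by (auto simp: P_def)
  have v': "v \<in> reached ?F j" if "j < k" for j
    using g(2)[of 0] that reached_mono[of "g (Suc 0)" ?F j] by (auto simp: R_def)
  have "full ?F"
    unfolding full_def
  proof (clarify)
    fix i e n j assume "(i, e) \<in> g n" "j < k"
    show "head e \<in> reached ?F j"
    proof (cases "(i, e) \<in> F")
      case True
      then have "head e \<in> reached F j" using F(2) \<open>j < k\<close> by (auto simp: full_def)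
      then show ?thesis using reached_mono[OF sub] by blast
    next
      case False
      \<comment> \<open>An arc added beyond \<open>F\<close> by stage \<open>n\<close> is taken care
        of at stage \<open>Suc n\<close>.\<close>
      then have "head e \<in> head ` snd ` (g n - F)" using \<open>(i, e) \<in> g n\<close> by force
      then have "head e \<in> reached (g (Suc n)) j" using g(2)[of n] \<open>j < k\<close> unfolding R_def by blast
      then show ?thesis using reached_mono[of "g (Suc n)" ?F j] by blast
    qed
  qed
  with part sub v' show ?thesis by blast
qed

text \<open>Zorn's lemma for assignments that are both \<open>partial\<close> and
  \<open>full\<close>; a maximal one spans, as \<open>extend_full\<close> would otherwise enlarge
  it.\<close>

lemma spanning_extension: "\<exists>F. partial F \<and> (\<forall>i<k. reached F i = V)"
proof -
  have empty: "partial {}" "full {}"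
    by (auto simp: partial_def full_def reached_def)
  have "\<exists>M\<in>{F. partial F \<and> full F}. \<forall>X\<in>{F. partial F \<and> full F}. M \<subseteq> X \<longrightarrow> X = M"
  proof (rule subset_Zorn_nonempty)
    fix C assume C: "C \<noteq> {}" "subset.chain {F. partial F \<and> full F} C"
    then have "\<And>A B. A \<in> C \<Longrightarrow> B \<in> C \<Longrightarrow> A \<subseteq> B \<or> B \<subseteq> A" "\<And>A. A \<in> C \<Longrightarrow> partial A \<and> full A"
      by (auto simp: subset_chain_def)
    then show "\<Union>C \<in> {F. partial F \<and> full F}" using partial_Union[of C] full_Union[of C] C(1) by blast
  qed (use empty in blast)
  then obtain M where M: "partial M" "full M"
    and max: "\<forall>X\<in>{F. partial F \<and> full F}. M \<subseteq> X \<longrightarrow> X = M" by blast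
  have "reached M i = V" if i: "i < k" for i
  proof
    have "M `` {i} \<subseteq> E0" using M(1) unfolding partial_def by blast
    then show "reached M i \<subseteq> V" using arcs_in Vs_in[OF i] unfolding reached_def by blast
    show "V \<subseteq> reached M i"
    proof
      fix v assume "v \<in> V"
      then obtain F' where F': "M \<subseteq> F'" "partial F'" "full F'" "v \<in> reached F' i"
        using extend_full[OF M] i by blast
      then have "F' = M" using max by simp
      with F'(4) show "v \<in> reached M i" by simp
    qed
  qed
  with M show ?thesis by blast
qed

end

section \<open>The equivalence\<close>

lemma rtrancl_enters:
  assumes "(r, x) \<in> (arc_rel tail head F)\<^sup>*" "r \<notin> X" "x \<in> X"
  shows "in_arcs tail head F X \<noteq> {}"
  using assms
proof (induction rule: rtrancl_induct)
  case (step y z)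
  then show ?case by (cases "y \<in> X") (auto simp: arc_rel_def in_arcs_def)
qed simp

theorem theorem1:
  fixes V :: "'v set" and A :: "'e set" and tail head :: "'e \<Rightarrow> 'v"
    and k :: nat and Vs :: "nat \<Rightarrow> 'v set" and As :: "nat \<Rightarrow> 'e set"
  assumes D: "is_digraph tail head V A"
    and B: "\<forall>i<k. branching_in tail head V A (Vs i) (As i)"
    and disj: "\<forall>i<k. \<forall>j<k. i \<noteq> j \<longrightarrow> As i \<inter> As j = {}"
    and noray: "\<not> has_forward_infinite_path tail head (A - (\<Union>i<k. As i))"
  shows "(\<exists>As' :: nat \<Rightarrow> 'e set.
            (\<forall>i<k. branching_in tail head V A V (As' i) \<and> As i \<subseteq> As' i \<and>
                   root_set tail head V (As' i) = root_set tail head (Vs i) (As i)) \<and>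
            (\<forall>i<k. \<forall>j<k. i \<noteq> j \<longrightarrow> As' i \<inter> As' j = {}))
         \<longleftrightarrow>
         (\<forall>X. X \<subseteq> V \<and> X \<noteq> {} \<longrightarrow>
              enat (card {i. i < k \<and> Vs i \<inter> X = {}}) \<le> rho tail head (A - (\<Union>i<k. As i)) X)"
    (is "?lhs \<longleftrightarrow> ?rhs")
proof
  let ?E = "A - (\<Union>i<k. As i)"
  have Vs: "Vs i \<subseteq> V" "As i \<subseteq> A" "is_branching tail head (Vs i) (As i)" "head ` As i \<subseteq> Vs i" if "i < k" for i
    using B that by (auto simp: branching_in_def is_branching_def is_digraph_def)
  {
    assume ?lhs
    then obtain As' where *: "(\<forall>i<k. branching_in tail head V A V (As' i) \<and> As i \<subseteq> As' i \<and>
        root_set tail head V (As' i) = root_set tail head (Vs i) (As i)) \<and>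
      (\<forall>i<k. \<forall>j<k. i \<noteq> j \<longrightarrow> As' i \<inter> As' j = {})" ..
    have As': "branching_in tail head V A V (As' i)" "As i \<subseteq> As' i"
      "root_set tail head V (As' i) = root_set tail head (Vs i) (As i)" if "i < k" for i
      using * that by simp_all
    have As'_disj: "As' i \<inter> As' j = {}" if "i < k" "j < k" "i \<noteq> j" for i j
      using * that by simp
    show ?rhs
    proof (intro allI impI)
      fix X assume X: "X \<subseteq> V \<and> X \<noteq> {}"
      let ?I = "{i. i < k \<and> Vs i \<inter> X = {}}"
      \<comment> \<open>The root of the component of \<open>x\<close> lies in \<open>Vs i\<close>,
        hence outside \<open>X\<close>, so the path from it to \<open>x\<close> enters
        \<open>X\<close> along an arc of \<open>As' i\<close>.\<close>
      have "\<exists>e. e \<in> As' i \<and> e \<in> in_arcs tail head ?E X" if i: "i \<in> ?I" for i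
      proof -
        obtain x where x: "x \<in> X" "x \<in> V" using X by auto
        have "is_branching tail head V (As' i)" using As'(1) i by (auto simp: branching_in_def)
        then obtain r where r: "r \<in> root_set tail head (Vs i) (As i)" "(r, x) \<in> (arc_rel tail head (As' i))\<^sup>*"
          using branching_component_root[of tail head V "As' i" x] x As'(3)[of i] i by auto
        then have "r \<notin> X" using i by (auto simp: root_set_def)
        then obtain e where e: "e \<in> As' i" "tail e \<notin> X" "head e \<in> X"
          using rtrancl_enters[OF r(2)] x by (auto simp: in_arcs_def)
        \<comment> \<open>Arcs of \<open>As i\<close> have heads in \<open>Vs i\<close>, outside
          \<open>X\<close>; for other \<open>j\<close>, \<open>As j\<close> lies in
          \<open>As' j\<close>, which is disjoint from \<open>As' i\<close>.\<close>
        have "e \<notin> As j" if "j < k" for j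
        proof (cases "j = i")
          case True
          then show ?thesis using Vs(4)[OF that] e i by auto
        next
          case False
          then show ?thesis using As'(2)[OF that] As'_disj[of i j] e i that by auto
        qed
        moreover have "e \<in> A" using As'(1)[of i] e i by (auto simp: branching_in_def)
        ultimately show ?thesis using e by (auto simp: in_arcs_def)
      qed
      then obtain h where h: "\<And>i. i \<in> ?I \<Longrightarrow> h i \<in> As' i \<and> h i \<in> in_arcs tail head ?E X" by metis
      have "inj_on h ?I"
      proof (rule inj_onI, rule ccontr)
        fix i j assume "i \<in> ?I" "j \<in> ?I" "h i = h j" "i \<noteq> j"
        then show False using h[of i] h[of j] As'_disj[of i j] by auto
      qed
      then show "enat (card ?I) \<le> rho tail head ?E X"
        unfolding enat_le_rho_iff using h by (auto intro: card_inj_on_le)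
    qed
  }
  {
    assume rhs: ?rhs
    interpret branching_cover tail head V ?E k Vs
    proof
      show "e \<in> ?E \<Longrightarrow> tail e \<in> V \<and> head e \<in> V" for e using D by (auto simp: is_digraph_def)
      show "card {i \<in> {..<k}. Vs i \<inter> X = {}} \<le> card (in_arcs tail head ?E X)"
        if "X \<subseteq> V" "X \<noteq> {}" "finite (in_arcs tail head ?E X)" for X
        using rhs that unfolding enat_le_rho_iff by simp
    qed (use Vs noray in auto)
    obtain F where F: "partial F" "\<And>i. i < k \<Longrightarrow> reached F i = V" using spanning_extension by blast
    define As' where "As' i = As i \<union> F `` {i}" for i
    have FE: "F `` {i} \<subseteq> ?E" for i using F(1) by (auto simp: partial_def)
    have inj: "inj_on head (F `` {i})" "head ` (F `` {i}) \<inter> Vs i = {}" for i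
      using F(1) by (auto simp: partial_def)
    \<comment> \<open>The heads of the added arcs are exactly the vertices outside
      \<open>Vs i\<close>, so the vertices without incoming arc, that is the roots, stay the
      same.\<close>
    have heads: "V - head ` As' i = Vs i - head ` As i" if "i < k" for i
      using F(2)[OF that] inj(2)[of i] Vs(4)[OF that] by (auto simp: As'_def reached_def)
    have br: "is_branching tail head V (As' i)" if i: "i < k" for i
    proof (rule is_branchingI)
      show "is_digraph tail head V (As' i)"
        using D Vs(2)[OF i] FE[of i] unfolding is_digraph_def As'_def by blast
      show "inj_on head (As' i)"
        unfolding As'_def inj_on_Un
        using branching_inj_on_head[OF Vs(3)[OF i]] inj[of i] Vs(4)[OF i] by blast
      fix w assume "w \<in> V"
      then have "w \<in> reached F i" using F(2)[OF i] by simp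
      then obtain s where s: "s \<in> Vs i" "(s, w) \<in> (arc_rel tail head (F `` {i}))\<^sup>*"
        using F(1) unfolding partial_def by blast
      obtain r where r: "r \<in> Vs i - head ` As i" "(r, s) \<in> (arc_rel tail head (As i))\<^sup>*"
        using branching_component_root[OF Vs(3)[OF i] s(1)] root_set_branching[OF Vs(3)[OF i]] by auto
      have "(r, s) \<in> (arc_rel tail head (As' i))\<^sup>*"
        using r(2) by (rule rtrancl_mono[THEN subsetD, rotated]) (auto simp: arc_rel_def As'_def)
      moreover have "(s, w) \<in> (arc_rel tail head (As' i))\<^sup>*"
        using s(2) by (rule rtrancl_mono[THEN subsetD, rotated]) (auto simp: arc_rel_def As'_def)
      ultimately show "\<exists>r\<in>V - head ` As' i. (r, w) \<in> (arc_rel tail head (As' i))\<^sup>*"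
        using r(1) heads[OF i] by (metis rtrancl_trans)
    qed
    show ?lhs
    proof (intro exI[of _ As'] conjI allI impI)
      fix i assume i: "i < k"
      show "branching_in tail head V A V (As' i)"
        using br[OF i] Vs(2)[OF i] FE[of i] unfolding branching_in_def As'_def by blast
      show "As i \<subseteq> As' i" by (simp add: As'_def)
      show "root_set tail head V (As' i) = root_set tail head (Vs i) (As i)"
        using root_set_branching[OF br[OF i]] root_set_branching[OF Vs(3)[OF i]] heads[OF i] by simp
    next
      fix i j assume ij: "i < k" "j < k" "i \<noteq> j"
      have "F `` {i} \<inter> F `` {j} = {}"
      proof -
        have "inj_on snd F" using F(1) by (simp add: partial_def)
        then have "i = j" if "(i, x) \<in> F" "(j, x) \<in> F" for x
          using that inj_onD[of snd F "(i, x)" "(j, x)"] by simp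
        then show ?thesis using ij(3) by auto
      qed
      moreover have "As i \<inter> As j = {}" using disj ij by blast
      moreover have "F `` {i} \<inter> As j = {}" "F `` {j} \<inter> As i = {}" using FE ij(1,2) by blast+
      ultimately show "As' i \<inter> As' j = {}" unfolding As'_def by blast
    qed
  }
qed

end
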